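(* Consider the Probabilistic Serial mechanism with $n$ agents and $m \le n$ items in the following dichotomous setting for agent 1. Agent 1 has a true strict linear order $\succ_1$ over the items; let $\overline{O}$ be the set of its $k$ most preferred items under $\succ_1$ (for some $1 \le k \le m$), and let agent 1's utility from an allocation be the total amount it receives of items in $\overline{O}$. Fix arbitrary reported strict linear orders of agents $2,\dots,n$. Let $u_1$ be agent 1's utility when it reports $\succ_1$, and let $T$ be the time at which the last item of $\overline{O}$ is exhausted in this truthful run. If $0 < T < \tfrac12$, then for every strict linear order $\succ'_1$ reported by agent 1, its resulting utility $u'_1$ satisfies $u'_1 \le \tfrac32 u_1$.
   Context: Probabilistic Serial: there are $n$ agents and $m$ divisible items of unit supply; each agent reports a strict linear order over all items. Starting at time $0$, every agent consumes at rate $1$ per unit time its most preferred item (according to its report) among those with positive remaining supply; when an item is exhausted, agents consuming it move to their most preferred item still available; this continues until all items are exhausted. Each agent's allocation is the amount of each item it consumed. (In the truthful run agent 1 eats only items of $\overline{O}$ until time $T$, so $u_1 = T$.) *)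

theory Defs
  imports Main "HOL.Real"
begin

text \<open>Probabilistic Serial (eating) mechanism.
  Agents are 0..<n (agent 1 of the paper is agent 0), items are 0..<m.
  A strict linear order over the items is a list enumerating all items,
  most preferred first.\<close>

definition is_pref :: "nat \<Rightarrow> nat list \<Rightarrow> bool" where
  "is_pref m p \<longleftrightarrow> distinct p \<and> set p = {0..<m}"

record ps_state =
  ps_time   :: real
  remaining :: "nat \<Rightarrow> real"
  alloc  :: "nat \<Rightarrow> nat \<Rightarrow> real"
  extime :: "nat \<Rightarrow> real"

definition ps_init :: "nat \<Rightarrow> ps_state" where
  "ps_init m = \<lparr> ps_time = 0, remaining = (\<lambda>j. if j < m then 1 else 0),
                 alloc = (\<lambda>i j. 0), extime = (\<lambda>j. 0) \<rparr>"

definition ps_top :: "ps_state \<Rightarrow> nat list \<Rightarrow> nat" where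
  "ps_top st p = hd (filter (\<lambda>j. remaining st j > 0) p)"

definition ps_eaters :: "nat \<Rightarrow> (nat \<Rightarrow> nat list) \<Rightarrow> ps_state \<Rightarrow> nat \<Rightarrow> nat" where
  "ps_eaters n P st j = card {i. i < n \<and> ps_top st (P i) = j}"

definition ps_step :: "nat \<Rightarrow> nat \<Rightarrow> (nat \<Rightarrow> nat list) \<Rightarrow> ps_state \<Rightarrow> ps_state" where
  "ps_step n m P st =
    (if {j. j < m \<and> remaining st j > 0} = {} then st else
     (let c = ps_eaters n P st;
          d = Min {remaining st j / real (c j) | j. j < m \<and> remaining st j > 0 \<and> c j > 0};
          s' = (\<lambda>j. if remaining st j > 0 then remaining st j - real (c j) * d else remaining st j)
      in \<lparr> ps_time = ps_time st + d,
           remaining = s',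
           alloc = (\<lambda>i j. if i < n \<and> remaining st j > 0 \<and> ps_top st (P i) = j
                           then alloc st i j + d else alloc st i j),
           extime = (\<lambda>j. if remaining st j > 0 \<and> s' j = 0 then ps_time st + d else extime st j) \<rparr>))"

text \<open>Each phase exhausts at least one item, so m phases finish the process.\<close>
definition ps_run :: "nat \<Rightarrow> nat \<Rightarrow> (nat \<Rightarrow> nat list) \<Rightarrow> ps_state" where
  "ps_run n m P = (ps_step n m P ^^ m) (ps_init m)"

definition PS_alloc :: "nat \<Rightarrow> nat \<Rightarrow> (nat \<Rightarrow> nat list) \<Rightarrow> nat \<Rightarrow> nat \<Rightarrow> real" where
  "PS_alloc n m P = alloc (ps_run n m P)"

definition PS_extime :: "nat \<Rightarrow> nat \<Rightarrow> (nat \<Rightarrow> nat list) \<Rightarrow> nat \<Rightarrow> real" where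
  "PS_extime n m P = extime (ps_run n m P)"

end

theory Submission
  imports Defs
begin

text \<open>
  Write \<open>r\<close> and \<open>r'\<close> for the remaining supplies in the truthful and in the manipulated run, and
  consider \<open>L(t) = (\<Sum>j. max 0 (r' j - r j))\<close> at time \<open>t\<close>. An agent other than the manipulator never
  makes \<open>L\<close> grow: if it eats \<open>a\<close> truthfully while \<open>r' a > r a\<close>, then in the manipulated run it eats
  \<open>a\<close> too, or an item that is better and hence exhausted in the truthful run. So \<open>L(T) \<le> T\<close>, and at
  time \<open>T\<close> at most \<open>T\<close> units of the top items are left in the manipulated run. As \<open>T < 1/2\<close>, each
  such item left has lost more than \<open>T\<close> by time \<open>T\<close>, so it has at least two eaters from then on, and
  the manipulator gets at most half of what is left: its utility is at most \<open>T + T/2\<close>.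
\<close>

section \<open>Eating dynamics on bare supply functions\<close>

text \<open>Follows \<open>ps_top\<close>, but depends on a supply function alone: steps of
  arbitrary length can then be studied without the clock and the other fields of a
  \<open>ps_state\<close>.\<close>

definition top_item :: "(nat \<Rightarrow> real) \<Rightarrow> nat list \<Rightarrow> nat" where
  "top_item r p = hd (filter (\<lambda>j. r j > 0) p)"

definition eaters :: "nat \<Rightarrow> (nat \<Rightarrow> nat list) \<Rightarrow> (nat \<Rightarrow> real) \<Rightarrow> nat \<Rightarrow> nat" where
  "eaters n P r j = card {i. i < n \<and> top_item r (P i) = j}"

text \<open>There is no truncation at zero. Overshooting is excluded by \<open>feasible\<close>
  instead, and linearity in \<open>d\<close> lets steps be split and merged.\<close>

definition eat :: "nat \<Rightarrow> (nat \<Rightarrow> nat list) \<Rightarrow> real \<Rightarrow> (nat \<Rightarrow> real) \<Rightarrow> nat \<Rightarrow> real" where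
  "eat n P d r = (\<lambda>j. r j - real (eaters n P r j) * d)"

fun eat_all :: "nat \<Rightarrow> (nat \<Rightarrow> nat list) \<Rightarrow> real list \<Rightarrow> (nat \<Rightarrow> real) \<Rightarrow> nat \<Rightarrow> real" where
  "eat_all n P [] r = r"
| "eat_all n P (d # ds) r = eat_all n P ds (eat n P d r)"

text \<open>
  The durations \<open>ds\<close> need not be those of full phases: an item may survive a step. This freedom is
  what allows two runs to be refined to common step lengths.
\<close>

fun feasible :: "nat \<Rightarrow> nat \<Rightarrow> (nat \<Rightarrow> nat list) \<Rightarrow> real list \<Rightarrow> (nat \<Rightarrow> real) \<Rightarrow> bool" where
  "feasible n m P [] r \<longleftrightarrow> (\<forall>j<m. 0 \<le> r j)"
| "feasible n m P (d # ds) r \<longleftrightarrow>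
     (\<forall>j<m. 0 \<le> r j) \<and> 0 < d \<and> (\<exists>j<m. 0 < r j) \<and> feasible n m P ds (eat n P d r)"

text \<open>Eating happens at unit rate, so the time that agent \<open>0\<close> spends on items of
  \<open>S\<close> is the amount of \<open>S\<close> that it receives.\<close>

fun gain :: "nat \<Rightarrow> (nat \<Rightarrow> nat list) \<Rightarrow> nat set \<Rightarrow> real list \<Rightarrow> (nat \<Rightarrow> real) \<Rightarrow> real" where
  "gain n P S [] r = 0"
| "gain n P S (d # ds) r = (if top_item r (P 0) \<in> S then d else 0) + gain n P S ds (eat n P d r)"

definition excess :: "nat \<Rightarrow> (nat \<Rightarrow> real) \<Rightarrow> (nat \<Rightarrow> real) \<Rightarrow> real" where
  "excess m r r' = (\<Sum>j<m. max 0 (r' j - r j))"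

section \<open>Favourite available items and numbers of eaters\<close>

text \<open>Each head is the first element of \<open>p\<close> with its own property. If each also
  has the other property, neither can precede the other.\<close>

lemma hd_filter_exchange:
  "Q (hd (filter R p)) \<Longrightarrow> R (hd (filter Q p)) \<Longrightarrow> hd (filter R p) = hd (filter Q p)"
  by (induction p) (auto split: if_splits)

text \<open>Used in two ways: for two moments of one run, where it shows that eaters stay with a
  surviving item, and for the same agent in two different runs.\<close>

lemma top_item_exchange:
  "0 < r' (top_item r p) \<Longrightarrow> 0 < r (top_item r' p) \<Longrightarrow> top_item r p = top_item r' p"
  unfolding top_item_def by (rule hd_filter_exchange)

lemma top_item_mem:
  assumes "j \<in> set p" "0 < r j"
  shows "top_item r p \<in> set p" "0 < r (top_item r p)"
proof -
  have "filter (\<lambda>j. r j > 0) p \<noteq> []"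
    using assms by (auto simp: filter_empty_conv)
  then have "top_item r p \<in> set (filter (\<lambda>j. r j > 0) p)"
    unfolding top_item_def by (rule hd_in_set)
  then show "top_item r p \<in> set p" "0 < r (top_item r p)" by auto
qed

lemma top_item_pref:
  assumes "is_pref m p" "j < m" "0 < r j"
  shows "top_item r p < m" "0 < r (top_item r p)"
  using top_item_mem[of j p r] assms by (auto simp: is_pref_def)

text \<open>The \<open>k\<close> best items form a prefix of \<open>p\<close>, so the search for an
  available item stops inside the prefix as long as it contains one.\<close>

lemma top_item_take:
  assumes "j \<in> set (take k p)" "0 < r j"
  shows "top_item r p \<in> set (take k p)"
proof -
  have "filter (\<lambda>j. r j > 0) (take k p) \<noteq> []"
    using assms by (auto simp: filter_empty_conv)
  then have "hd (filter (\<lambda>j. r j > 0) (take k p @ drop k p)) = top_item r (take k p)"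
    unfolding filter_append top_item_def by simp
  then have "top_item r p = top_item r (take k p)"
    by (simp add: top_item_def)
  then show ?thesis using top_item_mem(1)[of j "take k p" r] assms by simp
qed

lemma top_item_cong:
  "(\<And>j. j \<in> set p \<Longrightarrow> 0 < r j \<longleftrightarrow> 0 < r' j) \<Longrightarrow> top_item r p = top_item r' p"
  unfolding top_item_def by (metis (mono_tags, lifting) filter_cong)

lemma eaters_cong:
  assumes "\<forall>i<n. is_pref m (P i)" "\<And>j. j < m \<Longrightarrow> 0 < r j \<longleftrightarrow> 0 < r' j"
  shows "eaters n P r j = eaters n P r' j"
proof -
  have "top_item r (P i) = top_item r' (P i)" if "i < n" for i
    using assms that by (intro top_item_cong) (auto simp: is_pref_def)
  then show ?thesis unfolding eaters_def by (metis (mono_tags, lifting))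
qed

lemma eaters_unavailable:
  assumes "\<forall>i<n. is_pref m (P i)" "\<exists>j<m. 0 < r j" "\<not> (j < m \<and> 0 < r j)"
  shows "eaters n P r j = 0"
proof -
  have "{i. i < n \<and> top_item r (P i) = j} = {}"
    using assms top_item_pref[of m _ _ r] by blast
  then show ?thesis unfolding eaters_def by simp
qed

lemma sum_eaters:
  assumes "finite B"
  shows "(\<Sum>j\<in>B. eaters n P r j) = card {i. i < n \<and> top_item r (P i) \<in> B}"
proof -
  have "{i. i < n \<and> top_item r (P i) \<in> B} = (\<Union>j\<in>B. {i. i < n \<and> top_item r (P i) = j})"
    by auto
  then show ?thesis
    unfolding eaters_def using assms by (simp only:) (subst card_UN_disjoint, auto)
qed

lemma eat_le: "0 \<le> d \<Longrightarrow> eat n P d r j \<le> r j"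
  by (simp add: eat_def)

text \<open>An eater of \<open>j\<close> does not leave while \<open>j\<close> lasts: its favourite
  after the step was already available before the step, so exchange identifies it with
  \<open>j\<close>.\<close>

lemma eaters_eat_mono:
  assumes "\<forall>i<n. is_pref m (P i)" "0 \<le> d" "j < m" "0 < eat n P d r j"
  shows "eaters n P r j \<le> eaters n P (eat n P d r) j"
proof -
  let ?r = "eat n P d r"
  have "top_item ?r (P i) = j" if i: "i < n" "top_item r (P i) = j" for i
  proof -
    have "0 < ?r (top_item ?r (P i))"
      using top_item_pref(2)[of m "P i" j ?r] assms i by simp
    then have "0 < r (top_item ?r (P i))"
      using eat_le[OF \<open>0 \<le> d\<close>] by (rule less_le_trans)
    then show ?thesis
      using top_item_exchange[of ?r r "P i"] i assms(4) by simp
  qed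
  then show ?thesis unfolding eaters_def by (intro card_mono) auto
qed

section \<open>Splitting steps and cutting schedules\<close>

text \<open>An item being eaten must still supply its eaters for the remaining time
  \<open>e\<close>, so it is positive after \<open>d\<close>. Hence availability and favourites do
  not change at the intermediate moment, and the two steps add up.\<close>

lemma eat_eat:
  assumes prefs: "\<forall>i<n. is_pref m (P i)" and "0 < d" "0 < e" and avail: "\<exists>j<m. 0 < r j"
    and nonneg: "\<forall>j<m. 0 \<le> eat n P (d + e) r j"
  shows "eat n P e (eat n P d r) = eat n P (d + e) r"
    "\<forall>j<m. 0 < eat n P d r j \<longleftrightarrow> 0 < r j"
    "\<forall>j<m. 0 \<le> eat n P d r j"
proof -
  have same: "0 < eat n P d r j \<longleftrightarrow> 0 < r j" if "j < m" for j
  proof (cases "eaters n P r j = 0")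
    case True
    then show ?thesis by (simp add: eat_def)
  next
    case False
    then have "0 < r j" using eaters_unavailable[OF prefs avail, of j] by auto
    moreover have "0 < real (eaters n P r j) * e" using False \<open>0 < e\<close> by simp
    moreover have "0 \<le> r j - real (eaters n P r j) * (d + e)"
      using nonneg that by (simp add: eat_def)
    ultimately show ?thesis by (simp add: eat_def algebra_simps)
  qed
  have "eaters n P (eat n P d r) j = eaters n P r j" for j
    using eaters_cong[OF prefs same] .
  then have "eat n P e (eat n P d r) = (\<lambda>j. eat n P d r j - real (eaters n P r j) * e)"
    by (simp only: eat_def[of n P e])
  also have "\<dots> = eat n P (d + e) r"
    by (auto simp: eat_def distrib_left)
  finally show "eat n P e (eat n P d r) = eat n P (d + e) r" .
  show "\<forall>j<m. 0 < eat n P d r j \<longleftrightarrow> 0 < r j" using same by blast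
  show "\<forall>j<m. 0 \<le> eat n P d r j"
  proof (intro allI impI)
    fix j assume "j < m"
    then have "0 \<le> eat n P (d + e) r j" using nonneg by blast
    also have "\<dots> \<le> eat n P d r j"
      using \<open>0 < e\<close> by (simp add: eat_def mult_left_mono)
    finally show "0 \<le> eat n P d r j" .
  qed
qed

lemma feasible_nonneg: "feasible n m P ds r \<Longrightarrow> \<forall>j<m. 0 \<le> r j"
  by (cases ds) auto

lemma feasible_sum_nonneg: "feasible n m P ds r \<Longrightarrow> 0 \<le> sum_list ds"
  by (induction ds arbitrary: r) force+

lemma feasible_sum_pos: "feasible n m P (d # ds) r \<Longrightarrow> 0 < sum_list (d # ds)"
  using feasible_sum_nonneg[of n m P ds] by force

lemma feasible_eat_all_nonneg: "feasible n m P ds r \<Longrightarrow> \<forall>j<m. 0 \<le> eat_all n P ds r j"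
  by (induction ds arbitrary: r) auto

lemma eat_all_le: "feasible n m P ds r \<Longrightarrow> eat_all n P ds r j \<le> r j"
proof (induction ds arbitrary: r)
  case (Cons d ds)
  have "eat_all n P ds (eat n P d r) j \<le> eat n P d r j" using Cons by simp
  also have "\<dots> \<le> r j" using Cons.prems by (intro eat_le) simp
  finally show ?case by simp
qed simp

text \<open>The refinement tool: the first step may be interrupted at any moment \<open>c\<close>
  without affecting the state reached or the gain.\<close>

lemma feasible_split_head:
  assumes prefs: "\<forall>i<n. is_pref m (P i)" and "0 < n"
    and "feasible n m P (d # ds) r" "0 < c" "c < d"
  shows "feasible n m P (c # (d - c) # ds) r"
    "eat n P (d - c) (eat n P c r) = eat n P d r"
    "gain n P S (c # (d - c) # ds) r = gain n P S (d # ds) r"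
proof -
  have avail: "\<exists>j<m. 0 < r j" and nonneg: "\<forall>j<m. 0 \<le> eat n P d r j"
    using assms(3) feasible_nonneg by auto
  note split = eat_eat[OF prefs, of c "d - c" r, simplified, OF \<open>0 < c\<close> \<open>c < d\<close> avail nonneg]
  show eq: "eat n P (d - c) (eat n P c r) = eat n P d r" by (rule split)
  have "\<exists>j<m. 0 < eat n P c r j" using split(2) avail by blast
  then show "feasible n m P (c # (d - c) # ds) r"
    using assms eq split(3) by simp
  have "top_item (eat n P c r) (P 0) = top_item r (P 0)"
    using prefs \<open>0 < n\<close> split(2) by (intro top_item_cong) (auto simp: is_pref_def)
  then show "gain n P S (c # (d - c) # ds) r = gain n P S (d # ds) r"
    using eq by simp
qed

text \<open>Allows one run to be inspected at a time dictated by another run, which may fall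
  strictly inside a step. That step is then split in two.\<close>

lemma feasible_split_time:
  assumes prefs: "\<forall>i<n. is_pref m (P i)" and "0 < n"
    and "feasible n m P ds r" "0 \<le> t" "t \<le> sum_list ds"
  shows "\<exists>ds1 ds2. feasible n m P ds1 r \<and> sum_list ds1 = t \<and>
    feasible n m P ds2 (eat_all n P ds1 r) \<and>
    gain n P S ds r = gain n P S ds1 r + gain n P S ds2 (eat_all n P ds1 r)"
  using assms(3-)
proof (induction ds arbitrary: r t)
  case Nil
  then show ?case by (intro exI[of _ "[]"]) auto
next
  case (Cons d ds)
  consider "t = 0" | "0 < t" "t < d" | "d \<le> t" using Cons.prems by linarith
  then show ?case
  proof cases
    case 1
    then show ?thesis
      using Cons.prems feasible_nonneg[OF Cons.prems(1)]
      by (intro exI[of _ "[]"] exI[of _ "d # ds"]) simp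
  next
    case 2
    note split = feasible_split_head[OF prefs \<open>0 < n\<close> Cons.prems(1) 2]
    have "feasible n m P [t] r"
      using split(1) feasible_nonneg by auto
    then show ?thesis
      using split(1) split(3)[of S]
      by (intro exI[of _ "[t]"] exI[of _ "(d - t) # ds"]) simp
  next
    case 3
    then obtain ds1 ds2 where ds: "feasible n m P ds1 (eat n P d r)" "sum_list ds1 = t - d"
      "feasible n m P ds2 (eat_all n P ds1 (eat n P d r))"
      "gain n P S ds (eat n P d r) = gain n P S ds1 (eat n P d r)
         + gain n P S ds2 (eat_all n P ds1 (eat n P d r))"
      using Cons.IH[of "eat n P d r" "t - d"] Cons.prems by auto
    then show ?thesis
      using Cons.prems by (intro exI[of _ "d # ds1"] exI[of _ ds2]) simp
  qed
qed

section \<open>Bounds on gain and consumption over a schedule\<close>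

lemma gain_nonneg: "feasible n m P ds r \<Longrightarrow> 0 \<le> gain n P S ds r"
  by (induction ds arbitrary: r) (auto intro!: add_nonneg_nonneg)

lemma gain_le_sum: "feasible n m P ds r \<Longrightarrow> gain n P S ds r \<le> sum_list ds"
  by (induction ds arbitrary: r) (auto intro!: add_mono, force)

lemma eaters_eat_all_mono:
  assumes prefs: "\<forall>i<n. is_pref m (P i)" and "feasible n m P ds r" "j < m"
    and "0 < eat_all n P ds r j"
  shows "eaters n P r j \<le> eaters n P (eat_all n P ds r) j"
  using assms(2-)
proof (induction ds arbitrary: r)
  case (Cons d ds)
  have "0 < eat n P d r j"
    using eat_all_le[of n m P ds "eat n P d r" j] Cons.prems by simp
  then have "eaters n P r j \<le> eaters n P (eat n P d r) j"
    using eaters_eat_mono[OF prefs, of d j r] Cons.prems by simp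
  also have "\<dots> \<le> eaters n P (eat_all n P (d # ds) r) j"
    using Cons by simp
  finally show ?case .
qed simp

text \<open>The number of eaters of a surviving item never decreases, so the final number bounds its
  rate of consumption throughout. Read backwards, a large loss in a short time forces many eaters at
  the end.\<close>

lemma eaten_le_eaters_times_duration:
  assumes prefs: "\<forall>i<n. is_pref m (P i)" and "feasible n m P ds r" "j < m"
    and "0 < eat_all n P ds r j"
  shows "r j - eat_all n P ds r j \<le> real (eaters n P (eat_all n P ds r) j) * sum_list ds"
  using assms(2-)
proof (induction ds arbitrary: r)
  case (Cons d ds)
  let ?c = "real (eaters n P (eat_all n P (d # ds) r) j)"
  have "real (eaters n P r j) \<le> ?c"
    using eaters_eat_all_mono[OF prefs Cons.prems] by simp
  then have "real (eaters n P r j) * d \<le> ?c * d"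
    using Cons.prems by (intro mult_right_mono) auto
  then have "r j - eat n P d r j \<le> ?c * d" by (simp add: eat_def)
  moreover have "eat n P d r j - eat_all n P (d # ds) r j \<le> ?c * sum_list ds"
    using Cons by simp
  ultimately show ?case by (simp add: algebra_simps)
qed simp

text \<open>Whenever agent \<open>0\<close> gains from \<open>S\<close>, its item has a second
  eater, so the total supply of \<open>S\<close> falls at least twice as fast as the gain grows. The
  assumption on eaters passes to later states because eaters stay with a surviving item.\<close>

lemma gain_le_half:
  assumes prefs: "\<forall>i<n. is_pref m (P i)" and "0 < n" and "S \<subseteq> {..<m}"
    and "feasible n m P ds r"
    and "\<forall>j\<in>S. 0 < r j \<longrightarrow> 2 \<le> eaters n P r j"
  shows "gain n P S ds r \<le> (\<Sum>j\<in>S. r j) / 2"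
  using assms(4-)
proof (induction ds arbitrary: r)
  case Nil
  then show ?case using \<open>S \<subseteq> {..<m}\<close> by (auto intro!: sum_nonneg)
next
  case (Cons d ds)
  let ?r = "eat n P d r"
  have fin: "finite S" using \<open>S \<subseteq> {..<m}\<close> finite_subset by blast
  have d: "0 < d" and avail: "\<exists>j<m. 0 < r j" using Cons.prems by auto
  have two: "2 \<le> eaters n P ?r j" if "j \<in> S" "0 < ?r j" for j
  proof -
    have "0 < r j" using that(2) eat_le[of d n P r j] d by simp
    then have "2 \<le> eaters n P r j" using Cons.prems(2) that(1) by blast
    also have "\<dots> \<le> eaters n P ?r j"
      using eaters_eat_mono[OF prefs, of d j r] d that \<open>S \<subseteq> {..<m}\<close> by auto
    finally show ?thesis .
  qed
  have IH: "gain n P S ds ?r \<le> (\<Sum>j\<in>S. ?r j) / 2"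
    using Cons.IH[of ?r] Cons.prems(1) two by simp
  have sum: "(\<Sum>j\<in>S. ?r j) = (\<Sum>j\<in>S. r j) - real (\<Sum>j\<in>S. eaters n P r j) * d"
    by (simp add: eat_def sum_subtractf sum_distrib_right)
  show ?case
  proof (cases "top_item r (P 0) \<in> S")
    case True
    have "0 < r (top_item r (P 0))"
      using avail top_item_pref(2)[of m "P 0" _ r] prefs \<open>0 < n\<close> by blast
    then have "2 \<le> eaters n P r (top_item r (P 0))"
      using Cons.prems(2) True by blast
    also have "\<dots> \<le> (\<Sum>j\<in>S. eaters n P r j)"
      using True fin by (intro member_le_sum) auto
    finally have "2 * d \<le> real (\<Sum>j\<in>S. eaters n P r j) * d"
      using d by (intro mult_right_mono) linarith+
    then show ?thesis using IH sum True by simp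
  next
    case False
    have "0 \<le> real (\<Sum>j\<in>S. eaters n P r j) * d"
      using d by (intro mult_nonneg_nonneg of_nat_0_le_iff) simp
    then show ?thesis using IH sum False by simp
  qed
qed

section \<open>Comparing two runs that differ in agent 0 only\<close>

text \<open>Over the set \<open>B\<close> of items that can carry excess after the step, the excess
  grows at a rate of at most the eaters of \<open>B\<close> in the first run minus those in the
  second. Agents with equal reports cannot make this difference positive, and agent \<open>0\<close>
  contributes at most one.\<close>

lemma excess_eat:
  assumes prefs: "\<forall>i<n. is_pref m (P i)" and prefs': "\<forall>i<n. is_pref m (P' i)"
    and agree: "\<And>i. 0 < i \<Longrightarrow> P' i = P i" and "0 < d"
    and feas: "feasible n m P (d # ds) r" and feas': "feasible n m P' (d # ds') r'"
  shows "excess m (eat n P d r) (eat n P' d r') \<le> excess m r r' + d"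
proof -
  let ?s = "eat n P d r" and ?s' = "eat n P' d r'"
  have avail: "\<exists>j<m. 0 < r j" and avail': "\<exists>j<m. 0 < r' j" using feas feas' by auto
  have nonneg: "\<forall>j<m. 0 \<le> r j" "\<forall>j<m. 0 \<le> ?s j" "\<forall>j<m. 0 \<le> ?s' j"
    using feas feas' feasible_nonneg[of n m P ds] feasible_nonneg[of n m P' ds'] by auto
  \<comment> \<open>Items exhausted in the first run contribute nonnegatively; they are added so that the
    item eaten in the second run lies in \<open>B\<close> even if it is used up exactly at the end of the step.\<close>
  define B where "B = {j. j < m \<and> (?s j < ?s' j \<or> r j = 0)}"
  have fin: "finite B" unfolding B_def by simp
  have B: "B \<subseteq> {..<m}" unfolding B_def by auto
  have zero: "?s j = 0" if "j < m" "r j = 0" for j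
    using eaters_unavailable[OF prefs avail, of j] that by (simp add: eat_def)
  have "excess m ?s ?s' = (\<Sum>j\<in>B. max 0 (?s' j - ?s j))"
    unfolding excess_def B_def by (intro sum.mono_neutral_right) auto
  also have "\<dots> = (\<Sum>j\<in>B. ?s' j - ?s j)"
    using zero nonneg(3) by (intro sum.cong) (auto simp: B_def max_def)
  also have "\<dots> = (\<Sum>j\<in>B. r' j - r j)
      + (real (\<Sum>j\<in>B. eaters n P r j) - real (\<Sum>j\<in>B. eaters n P' r' j)) * d"
    by (simp add: eat_def sum_subtractf left_diff_distrib flip: sum_distrib_right)
  also have "(\<Sum>j\<in>B. r' j - r j) \<le> (\<Sum>j\<in>B. max 0 (r' j - r j))"
    by (intro sum_mono) simp
  also have "\<dots> \<le> excess m r r'"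
    unfolding excess_def using B by (intro sum_mono2) auto
  also have "(real (\<Sum>j\<in>B. eaters n P r j) - real (\<Sum>j\<in>B. eaters n P' r' j)) * d \<le> 1 * d"
  proof (intro mult_right_mono)
    \<comment> \<open>Only agent \<open>0\<close> may eat from \<open>B\<close> in the first run
      without doing so in the second; it accounts for the bound \<open>1\<close>.\<close>
    have "{i. i < n \<and> top_item r (P i) \<in> B} \<subseteq> insert 0 {i. i < n \<and> top_item r' (P' i) \<in> B}"
    proof
      fix i assume "i \<in> {i. i < n \<and> top_item r (P i) \<in> B}"
      then have i: "i < n" "top_item r (P i) \<in> B" by auto
      show "i \<in> insert 0 {i. i < n \<and> top_item r' (P' i) \<in> B}"
      proof (cases "i = 0")
        case False
        let ?a = "top_item r (P i)" and ?b = "top_item r' (P i)"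
        have eq: "P' i = P i" using agree False by simp
        have a: "?a < m" "0 < r ?a"
          using avail top_item_pref[of m "P i" _ r] prefs i by blast+
        have b: "?b < m"
          using avail' top_item_pref[of m "P i" _ r'] prefs i by blast
        \<comment> \<open>As \<open>r ?a\<close> is positive, \<open>?a\<close> belongs to
          \<open>B\<close> by the first clause. So it survives the step in the second run and was
          available there at its start.\<close>
        have "?s ?a < ?s' ?a" using i a unfolding B_def by auto
        then have "0 < ?s' ?a" using nonneg(2) a(1) by force
        then have ra: "0 < r' ?a" using eat_le[of d n P' r' ?a] \<open>0 < d\<close> by simp
        \<comment> \<open>The agent could eat \<open>?a\<close> in the second run. If
          \<open>?b\<close> is also available in the first run, exchange makes the two equal;
          otherwise the second clause of \<open>B\<close> applies.\<close>
        have "?b \<in> B"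
        proof (cases "r ?b = 0")
          case True
          then show ?thesis using b unfolding B_def by simp
        next
          case False
          then have "0 < r ?b" using nonneg(1) b by force
          then have "?a = ?b" using top_item_exchange[of r' r "P i"] ra by simp
          then show ?thesis using i(2) by simp
        qed
        then show ?thesis using i eq by simp
      qed simp
    qed
    then have "card {i. i < n \<and> top_item r (P i) \<in> B}
        \<le> card (insert 0 {i. i < n \<and> top_item r' (P' i) \<in> B})"
      by (intro card_mono) auto
    also have "\<dots> \<le> Suc (card {i. i < n \<and> top_item r' (P' i) \<in> B})"
      by (simp add: card_insert_if)
    finally show "real (\<Sum>j\<in>B. eaters n P r j) - real (\<Sum>j\<in>B. eaters n P' r' j) \<le> 1"
      unfolding sum_eaters[OF fin] by linarith
  qed (use \<open>0 < d\<close> in simp)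
  finally show ?thesis by simp
qed

text \<open>The longer of the two first steps is cut to the length of the shorter, so that
  \<open>excess_eat\<close> applies to steps of a common duration.\<close>

lemma excess_eat_all:
  assumes prefs: "\<forall>i<n. is_pref m (P i)" and prefs': "\<forall>i<n. is_pref m (P' i)"
    and agree: "\<And>i. 0 < i \<Longrightarrow> P' i = P i" and "0 < n"
    and "feasible n m P ds r" "feasible n m P' ds' r'" "sum_list ds = sum_list ds'"
  shows "excess m (eat_all n P ds r) (eat_all n P' ds' r') \<le> excess m r r' + sum_list ds"
  using assms(5-)
\<comment> \<open>A cut leaves a remainder in one list but removes the whole first step of the
  other, so the combined length still drops.\<close>
proof (induction "length ds + length ds'" arbitrary: ds ds' r r' rule: less_induct)
  case less
  show ?case
  proof (cases "ds = [] \<or> ds' = []")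
    case True
    then have "ds = [] \<and> ds' = []"
      using less.prems feasible_sum_pos
      by (metis less_irrefl neq_Nil_conv sum_list.Nil)
    then show ?thesis by simp
  next
    case False
    then obtain d es d' es' where ds: "ds = d # es" "ds' = d' # es'"
      by (meson neq_Nil_conv)
    have pos: "0 < d" "0 < d'" using less.prems ds by auto
    note feas = less.prems(1,2)[unfolded ds]
    consider "d = d'" | "d < d'" | "d' < d" by linarith
    then show ?thesis
    proof cases
      case 1
      then have "excess m (eat_all n P ds r) (eat_all n P' ds' r')
          \<le> excess m (eat n P d r) (eat n P' d r') + sum_list es"
        using less.hyps[of es es' "eat n P d r" "eat n P' d r'"] less.prems ds by simp
      moreover have "excess m (eat n P d r) (eat n P' d r') \<le> excess m r r' + d"
        using excess_eat[OF prefs prefs' agree pos(1)] feas 1 by blast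
      ultimately show ?thesis using ds by simp
    next
      case 2
      note split = feasible_split_head[OF prefs' \<open>0 < n\<close> feas(2) pos(1) 2]
      have "excess m (eat_all n P ds r) (eat_all n P' ds' r')
          \<le> excess m (eat n P d r) (eat n P' d r') + sum_list es"
        using less.hyps[of es "(d' - d) # es'" "eat n P d r" "eat n P' d r'"] less.prems ds split
        by simp
      moreover have "excess m (eat n P d r) (eat n P' d r') \<le> excess m r r' + d"
        using excess_eat[OF prefs prefs' agree pos(1)] feas(1) split(1) by blast
      ultimately show ?thesis using ds by simp
    next
      case 3
      note split = feasible_split_head[OF prefs \<open>0 < n\<close> feas(1) pos(2) 3]
      have "excess m (eat_all n P ds r) (eat_all n P' ds' r')
          \<le> excess m (eat n P d' r) (eat n P' d' r') + sum_list es'"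
        using less.hyps[of "(d - d') # es" es' "eat n P d' r" "eat n P' d' r'"] less.prems ds split
        by simp
      moreover have "excess m (eat n P d' r) (eat n P' d' r') \<le> excess m r r' + d'"
        using excess_eat[OF prefs prefs' agree pos(2)] feas(2) split(1) by blast
      ultimately show ?thesis using ds less.prems(3) by simp
    qed
  qed
qed

section \<open>From the mechanism to schedules\<close>

text \<open>The bridge to the mechanism: a phase is one \<open>eat\<close> step whose length
  \<open>d\<close> is the least time in which some eaten item runs out.\<close>

lemma ps_step_eat:
  assumes prefs: "\<forall>i<n. is_pref m (P i)" and "0 < n"
    and avail: "\<exists>j<m. 0 < remaining st j"
  obtains d where "0 < d" "remaining (ps_step n m P st) = eat n P d (remaining st)"
    "\<forall>j<m. 0 \<le> remaining st j \<longrightarrow> 0 \<le> eat n P d (remaining st) j"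
    "\<exists>j<m. 0 < remaining st j \<and> eat n P d (remaining st) j = 0"
    "ps_time (ps_step n m P st) = ps_time st + d"
    "\<And>S. finite S \<Longrightarrow> (\<Sum>j\<in>S. alloc (ps_step n m P st) 0 j)
       = (\<Sum>j\<in>S. alloc st 0 j) + (if top_item (remaining st) (P 0) \<in> S then d else 0)"
    "\<And>j. extime (ps_step n m P st) j = (if 0 < remaining st j \<and> eat n P d (remaining st) j = 0
       then ps_time st + d else extime st j)"
proof -
  let ?r = "remaining st"
  have top: "ps_top st = top_item ?r"
    by (auto simp: ps_top_def top_item_def)
  have eaters: "ps_eaters n P st = eaters n P ?r"
    by (auto simp: ps_eaters_def eaters_def top)
  define D where "D = {?r j / real (eaters n P ?r j) | j. j < m \<and> 0 < ?r j \<and> 0 < eaters n P ?r j}"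
  define d where "d = Min D"
  have "D = (\<lambda>j. ?r j / real (eaters n P ?r j)) ` {j. j < m \<and> 0 < ?r j \<and> 0 < eaters n P ?r j}"
    unfolding D_def by auto
  then have "finite D" by simp
  have top0: "top_item ?r (P 0) < m" "0 < ?r (top_item ?r (P 0))"
    using avail top_item_pref[of m "P 0" _ ?r] prefs \<open>0 < n\<close> by blast+
  have "0 < eaters n P ?r (top_item ?r (P 0))"
    unfolding eaters_def using \<open>0 < n\<close> by (auto simp: card_gt_0_iff)
  \<comment> \<open>The favourite of agent \<open>0\<close> has at least one eater, so the minimum
    is taken over a nonempty set and is attained by an item that the phase exhausts.\<close>
  then have "D \<noteq> {}" using top0 unfolding D_def by blast
  then have "d \<in> D" unfolding d_def using \<open>finite D\<close> by simp
  then obtain j0 where j0: "j0 < m" "0 < ?r j0" "0 < eaters n P ?r j0"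
    "d = ?r j0 / real (eaters n P ?r j0)"
    unfolding D_def by blast
  have dpos: "0 < d" using j0 by simp
  have s': "(if 0 < ?r j then ?r j - real (eaters n P ?r j) * d else ?r j) = eat n P d ?r j" for j
    using eaters_unavailable[OF prefs avail, of j] by (auto simp: eat_def)
  have step: "ps_step n m P st = \<lparr> ps_time = ps_time st + d, remaining = eat n P d ?r,
      alloc = (\<lambda>i j. if i < n \<and> 0 < ?r j \<and> top_item ?r (P i) = j
                      then alloc st i j + d else alloc st i j),
      extime = (\<lambda>j. if 0 < ?r j \<and> eat n P d ?r j = 0 then ps_time st + d else extime st j) \<rparr>"
    using avail unfolding ps_step_def Let_def eaters top D_def[symmetric] d_def[symmetric] s'
    by (subst if_not_P) blast+
  have "0 \<le> eat n P d ?r j" if j: "j < m" "0 \<le> ?r j" for j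
  proof (cases "0 < ?r j \<and> 0 < eaters n P ?r j")
    case True
    then have "?r j / real (eaters n P ?r j) \<in> D" using j unfolding D_def by blast
    then have "d \<le> ?r j / real (eaters n P ?r j)" unfolding d_def using \<open>finite D\<close> by simp
    then show ?thesis using True by (simp add: eat_def field_simps)
  next
    case False
    then have "eaters n P ?r j = 0" using eaters_unavailable[OF prefs avail, of j] by auto
    then show ?thesis using j by (simp add: eat_def)
  qed
  moreover have "\<exists>j<m. 0 < ?r j \<and> eat n P d ?r j = 0"
    using j0 by (intro exI[of _ j0]) (simp add: eat_def)
  moreover have "(\<Sum>j\<in>S. alloc (ps_step n m P st) 0 j)
       = (\<Sum>j\<in>S. alloc st 0 j) + (if top_item ?r (P 0) \<in> S then d else 0)" if "finite S" for S
  proof -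
    have "alloc (ps_step n m P st) 0 j
        = alloc st 0 j + (if top_item ?r (P 0) = j then d else 0)" for j
      using top0(2) \<open>0 < n\<close> by (auto simp: step)
    then show ?thesis using that by (simp add: sum.distrib)
  qed
  ultimately show thesis using dpos by (intro that[of d]) (simp_all add: step)
qed

lemma ps_step_exhausted:
  "\<not> (\<exists>j<m. 0 < remaining st j) \<Longrightarrow> ps_step n m P st = st"
  by (auto simp: ps_step_def)

text \<open>Phases after total exhaustion are idle and add no entry, so \<open>ds\<close> may be
  shorter than \<open>q\<close>. The start is arbitrary so that the lemma also covers the tail of a
  run.\<close>

lemma ps_steps_feasible:
  assumes prefs: "\<forall>i<n. is_pref m (P i)" and "0 < n" and "finite S"
    and "\<forall>j<m. 0 \<le> remaining st j"
  shows "\<exists>ds. feasible n m P ds (remaining st)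
    \<and> remaining ((ps_step n m P ^^ q) st) = eat_all n P ds (remaining st)
    \<and> ps_time ((ps_step n m P ^^ q) st) = ps_time st + sum_list ds
    \<and> (\<Sum>j\<in>S. alloc ((ps_step n m P ^^ q) st) 0 j)
        = (\<Sum>j\<in>S. alloc st 0 j) + gain n P S ds (remaining st)"
  using assms(4-)
proof (induction q arbitrary: st)
  case 0
  then show ?case by (intro exI[of _ "[]"]) simp
next
  case (Suc q)
  show ?case
  proof (cases "\<exists>j<m. 0 < remaining st j")
    case True
    obtain d where d: "0 < d" "remaining (ps_step n m P st) = eat n P d (remaining st)"
      "\<forall>j<m. 0 \<le> remaining st j \<longrightarrow> 0 \<le> eat n P d (remaining st) j"
      "ps_time (ps_step n m P st) = ps_time st + d"
      "(\<Sum>j\<in>S. alloc (ps_step n m P st) 0 j)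
         = (\<Sum>j\<in>S. alloc st 0 j) + (if top_item (remaining st) (P 0) \<in> S then d else 0)"
      by (rule ps_step_eat[OF prefs \<open>0 < n\<close> True]) (erule that; simp add: \<open>finite S\<close>)
    have "\<forall>j<m. 0 \<le> remaining (ps_step n m P st) j" using d Suc.prems by simp
    from Suc.IH[OF this] obtain ds where ds:
      "feasible n m P ds (eat n P d (remaining st))"
      "remaining ((ps_step n m P ^^ q) (ps_step n m P st)) = eat_all n P ds (eat n P d (remaining st))"
      "ps_time ((ps_step n m P ^^ q) (ps_step n m P st)) = ps_time st + d + sum_list ds"
      "(\<Sum>j\<in>S. alloc ((ps_step n m P ^^ q) (ps_step n m P st)) 0 j)
        = (\<Sum>j\<in>S. alloc (ps_step n m P st) 0 j) + gain n P S ds (eat n P d (remaining st))"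
      unfolding d(2,4) by blast
    then show ?thesis
      using d True Suc.prems
      by (intro exI[of _ "d # ds"]) (simp add: funpow_swap1)
  next
    case False
    then show ?thesis
      using Suc.IH[OF Suc.prems] by (simp add: funpow_swap1 ps_step_exhausted)
  qed
qed

lemma ps_init_simps:
  "remaining (ps_init m) = (\<lambda>j. if j < m then 1 else 0)" "ps_time (ps_init m) = 0"
  "alloc (ps_init m) = (\<lambda>i j. 0)"
  by (simp_all add: ps_init_def)

lemma ps_steps_nonneg:
  assumes "\<forall>i<n. is_pref m (P i)" and "0 < n"
  shows "\<forall>j<m. 0 \<le> remaining ((ps_step n m P ^^ q) (ps_init m)) j"
  using ps_steps_feasible[OF assms finite.emptyI, of "ps_init m" q] feasible_eat_all_nonneg
  by (fastforce simp: ps_init_simps)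

text \<open>Every phase that is not idle removes an available item, and supplies never grow. This is
  why \<open>m\<close> phases finish the process.\<close>

lemma ps_steps_exhaust:
  assumes prefs: "\<forall>i<n. is_pref m (P i)" and "0 < n"
  shows "card {j. j < m \<and> 0 < remaining ((ps_step n m P ^^ q) (ps_init m)) j} \<le> m - q"
proof (induction q)
  case 0
  then show ?case by (simp add: ps_init_simps)
next
  case (Suc q)
  let ?st = "(ps_step n m P ^^ q) (ps_init m)"
  show ?case
  proof (cases "\<exists>j<m. 0 < remaining ?st j")
    case True
    obtain d where d: "0 < d" "remaining (ps_step n m P ?st) = eat n P d (remaining ?st)"
      "\<exists>j<m. 0 < remaining ?st j \<and> eat n P d (remaining ?st) j = 0"
      by (rule ps_step_eat[OF prefs \<open>0 < n\<close> True]) (erule that; simp)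
    have "0 < remaining ?st j" if "0 < eat n P d (remaining ?st) j" for j
      using less_le_trans[OF that eat_le] d(1) by simp
    moreover obtain j where "j < m" "0 < remaining ?st j" "\<not> 0 < eat n P d (remaining ?st) j"
      using d(3) by force
    ultimately have "{j. j < m \<and> 0 < eat n P d (remaining ?st) j} \<subset> {j. j < m \<and> 0 < remaining ?st j}"
      by blast
    then have "card {j. j < m \<and> 0 < eat n P d (remaining ?st) j}
        < card {j. j < m \<and> 0 < remaining ?st j}"
      by (intro psubset_card_mono) auto
    then show ?thesis using Suc d(2) by simp
  next
    case False
    then have "{j. j < m \<and> 0 < remaining ?st j} = {}" by auto
    then have "card {j. j < m \<and> 0 < remaining ?st j} = 0" by (simp only: card.empty)
    moreover have "(ps_step n m P ^^ Suc q) (ps_init m) = ?st"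
      using ps_step_exhausted[OF False] by simp
    ultimately show ?thesis by (simp only: le0)
  qed
qed

lemma ps_run_exhausted:
  assumes "\<forall>i<n. is_pref m (P i)" and "0 < n" "j < m"
  shows "remaining (ps_run n m P) j = 0"
proof -
  have "{j. j < m \<and> 0 < remaining (ps_run n m P) j} = {}"
    using ps_steps_exhaust[OF assms(1,2), of m] by (simp add: ps_run_def)
  then have "\<not> 0 < remaining (ps_run n m P) j" using \<open>j < m\<close> by blast
  moreover have "0 \<le> remaining (ps_run n m P) j"
    using ps_steps_nonneg[OF assms(1,2), of m] \<open>j < m\<close> by (simp add: ps_run_def)
  ultimately show ?thesis by simp
qed

text \<open>An exhaustion time is written only when a positive supply reaches zero, so the value in
  the final state can be read off right after the item runs out.\<close>

lemma extime_stable: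
  assumes prefs: "\<forall>i<n. is_pref m (P i)" and "0 < n" "remaining st j = 0"
  shows "extime ((ps_step n m P ^^ q) st) j = extime st j"
  using assms(3)
proof (induction q arbitrary: st)
  case (Suc q)
  show ?case
  proof (cases "\<exists>j<m. 0 < remaining st j")
    case True
    obtain d where d: "0 < d" "remaining (ps_step n m P st) = eat n P d (remaining st)"
      "extime (ps_step n m P st) j = extime st j"
      by (rule ps_step_eat[OF prefs \<open>0 < n\<close> True]) (erule that; simp add: Suc.prems)
    then have "remaining (ps_step n m P st) j = 0"
      using eaters_unavailable[OF prefs True, of j] Suc.prems by (simp add: eat_def)
    then show ?thesis using Suc.IH d(3) by (simp add: funpow_swap1)
  next
    case False
    then show ?thesis using Suc by (simp add: funpow_swap1 ps_step_exhausted)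
  qed
qed simp

text \<open>While one of its \<open>k\<close> best items is left, agent \<open>0\<close> eats from
  this prefix at unit rate, so its utility keeps pace with the clock.\<close>

lemma alloc_eq_time_while_available:
  assumes prefs: "\<forall>i<n. is_pref m (P i)" and "0 < n"
    and "\<forall>q'<q. \<exists>j\<in>set (take k (P 0)). 0 < remaining ((ps_step n m P ^^ q') (ps_init m)) j"
  shows "(\<Sum>j\<in>set (take k (P 0)). alloc ((ps_step n m P ^^ q) (ps_init m)) 0 j)
    = ps_time ((ps_step n m P ^^ q) (ps_init m))"
  using assms(3)
proof (induction q)
  case 0
  then show ?case by (simp add: ps_init_simps)
next
  case (Suc q)
  let ?st = "(ps_step n m P ^^ q) (ps_init m)"
  obtain j where j: "j \<in> set (take k (P 0))" "0 < remaining ?st j" using Suc.prems by blast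
  then have "j < m" using in_set_takeD[OF j(1)] prefs \<open>0 < n\<close> by (auto simp: is_pref_def)
  then have avail: "\<exists>j<m. 0 < remaining ?st j" using j(2) by blast
  have "top_item (remaining ?st) (P 0) \<in> set (take k (P 0))"
    using top_item_take[of j k "P 0" "remaining ?st"] j by blast
  moreover obtain d where "0 < d" "ps_time (ps_step n m P ?st) = ps_time ?st + d"
    "(\<Sum>j\<in>set (take k (P 0)). alloc (ps_step n m P ?st) 0 j) = (\<Sum>j\<in>set (take k (P 0)). alloc ?st 0 j)
       + (if top_item (remaining ?st) (P 0) \<in> set (take k (P 0)) then d else 0)"
    by (rule ps_step_eat[OF prefs \<open>0 < n\<close> avail]) (erule that; simp)
  ultimately show ?case using Suc by simp
qed

section \<open>The bound of three halves\<close>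

theorem theorem1:
  fixes n m k :: nat and P :: "nat \<Rightarrow> nat list" and p' :: "nat list"
  assumes "m \<le> n" and "1 \<le> k" and "k \<le> m"
    and "\<forall>i<n. is_pref m (P i)"
    and "is_pref m p'"
    and "T = Max (PS_extime n m P ` set (take k (P 0)))"
    and "0 < T" and "T < 1/2"
  shows "(\<Sum>j\<in>set (take k (P 0)). PS_alloc n m (P(0 := p')) 0 j)
         \<le> 3/2 * (\<Sum>j\<in>set (take k (P 0)). PS_alloc n m P 0 j)"
proof -
  define S where "S = set (take k (P 0))"
  define P' where "P' = P(0 := p')"
  define r0 :: "nat \<Rightarrow> real" where "r0 = (\<lambda>j. if j < m then 1 else 0)"
  define st where "st q = (ps_step n m P ^^ q) (ps_init m)" for q
  have prefs: "\<forall>i<n. is_pref m (P i)" by fact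
  have prefs': "\<forall>i<n. is_pref m (P' i)" using assms by (simp add: P'_def)
  have "0 < n" using assms by linarith
  have S: "S \<subseteq> {..<m}" "finite S" "S \<noteq> {}"
  proof -
    have P0: "is_pref m (P 0)" using prefs \<open>0 < n\<close> by blast
    then show "S \<subseteq> {..<m}" using set_take_subset[of k "P 0"] by (auto simp: S_def is_pref_def)
    have "P 0 \<noteq> []" using P0 assms by (auto simp: is_pref_def)
    then show "S \<noteq> {}" using assms by (simp add: S_def)
  qed (simp add: S_def)

  \<comment> \<open>The number of phases after which the top items are first all gone in the
    truthful run; the clock then shows \<open>t\<close>.\<close>
  define q where "q = (LEAST q. \<forall>j\<in>S. remaining (st q) j = 0)"
  have "\<forall>j\<in>S. remaining (st m) j = 0"
    using ps_run_exhausted[OF prefs \<open>0 < n\<close>] S by (auto simp: st_def ps_run_def)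
  then have q: "\<forall>j\<in>S. remaining (st q) j = 0" and "q \<le> m"
    unfolding q_def by (rule LeastI, rule Least_le)
  have before: "\<exists>j\<in>S. 0 < remaining (st q') j" if "q' < q" for q'
  proof -
    have "\<not> (\<forall>j\<in>S. remaining (st q') j = 0)"
      using that not_less_Least unfolding q_def by blast
    then obtain j where "j \<in> S" "remaining (st q') j \<noteq> 0" by blast
    moreover have "0 \<le> remaining (st q') j"
      using ps_steps_nonneg[OF prefs \<open>0 < n\<close>] S(1) \<open>j \<in> S\<close> unfolding st_def by blast
    ultimately show ?thesis by force
  qed
  define t where "t = ps_time (st q)"
  have run: "ps_run n m P = (ps_step n m P ^^ (m - q)) (st q)"
    using \<open>q \<le> m\<close> funpow_add[of "m - q" q "ps_step n m P"] by (simp add: ps_run_def st_def)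

  \<comment> \<open>The phase before \<open>q\<close> still has a top item left. That item is
    exhausted in the last of the \<open>q\<close> phases, so its exhaustion time is
    \<open>t\<close>, which the maximum \<open>T\<close> dominates.\<close>
  have "t \<le> T"
  proof -
    have "q \<noteq> 0"
    proof
      assume "q = 0"
      obtain j where j: "j \<in> S" using S(3) by blast
      then have "remaining (st 0) j = 1" using S(1) by (auto simp: st_def ps_init_simps)
      then show False using q j \<open>q = 0\<close> by simp
    qed
    then obtain q1 where q1: "q = Suc q1" using not0_implies_Suc by blast
    obtain j where j: "j \<in> S" "0 < remaining (st q1) j" using before q1 by blast
    have step: "st q = ps_step n m P (st q1)" by (simp add: q1 st_def)
    have avail: "\<exists>j<m. 0 < remaining (st q1) j" using j S by blast
    have "extime (st q) j = t"
    proof (rule ps_step_eat[OF prefs \<open>0 < n\<close> avail])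
      fix d
      assume "remaining (ps_step n m P (st q1)) = eat n P d (remaining (st q1))"
        "ps_time (ps_step n m P (st q1)) = ps_time (st q1) + d"
        "\<And>j. extime (ps_step n m P (st q1)) j =
           (if 0 < remaining (st q1) j \<and> eat n P d (remaining (st q1)) j = 0
            then ps_time (st q1) + d else extime (st q1) j)"
      then show ?thesis using j q unfolding t_def step by simp
    qed
    then have "PS_extime n m P j = t"
      using run extime_stable[OF prefs \<open>0 < n\<close>] q j by (simp add: PS_extime_def)
    then show ?thesis using assms(6) j S by (auto simp: S_def)
  qed

  \<comment> \<open>The first \<open>q\<close> phases give agent \<open>0\<close> exactly
    \<open>t\<close>, and later phases cannot take anything away.\<close>
  have truthful: "t \<le> (\<Sum>j\<in>S. PS_alloc n m P 0 j)"
  proof -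
    have "(\<Sum>j\<in>S. alloc (st q) 0 j) = t"
      using alloc_eq_time_while_available[OF prefs \<open>0 < n\<close>, of q k] before
      by (simp add: t_def st_def S_def)
    moreover obtain ds where "feasible n m P ds (remaining (st q))"
      "(\<Sum>j\<in>S. PS_alloc n m P 0 j) = (\<Sum>j\<in>S. alloc (st q) 0 j) + gain n P S ds (remaining (st q))"
      using ps_steps_feasible[OF prefs \<open>0 < n\<close> S(2) ps_steps_nonneg[OF prefs \<open>0 < n\<close>, of q],
          of "m - q"] unfolding PS_alloc_def run st_def by blast
    ultimately show ?thesis using gain_nonneg[of n m P ds "remaining (st q)" S] by simp
  qed

  have init: "\<forall>j<m. 0 \<le> remaining (ps_init m) j" by (simp add: ps_init_simps)
  have rinit: "remaining (ps_init m) = r0" by (simp add: ps_init_simps r0_def)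
  obtain ds where ds: "feasible n m P ds r0" "remaining (st q) = eat_all n P ds r0"
    "t = sum_list ds"
    using ps_steps_feasible[OF prefs \<open>0 < n\<close> S(2) init, of q]
    by (auto simp: rinit ps_init_simps(2,3) st_def t_def)
  obtain ds' where ds': "feasible n m P' ds' r0"
    "(\<Sum>j\<in>S. PS_alloc n m P' 0 j) = gain n P' S ds' r0"
    using ps_steps_feasible[OF prefs' \<open>0 < n\<close> S(2) init, of m]
    by (auto simp: rinit ps_init_simps(2,3) PS_alloc_def ps_run_def)
  have "0 \<le> t" using ds feasible_sum_nonneg by blast

  have "gain n P' S ds' r0 \<le> 3/2 * t"
  \<comment> \<open>If the manipulated run is over before \<open>t\<close>, its gain is below
    \<open>t\<close> already; otherwise it is cut at time \<open>t\<close>.\<close>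
  proof (cases "t \<le> sum_list ds'")
    case False
    then show ?thesis using gain_le_sum[OF ds'(1), of S] \<open>0 \<le> t\<close> by simp
  next
    case True
    obtain ds1 ds2 where split: "feasible n m P' ds1 r0" "sum_list ds1 = t"
      "feasible n m P' ds2 (eat_all n P' ds1 r0)"
      "gain n P' S ds' r0 = gain n P' S ds1 r0 + gain n P' S ds2 (eat_all n P' ds1 r0)"
      using feasible_split_time[OF prefs' \<open>0 < n\<close> ds'(1) \<open>0 \<le> t\<close> True] by blast
    let ?r = "eat_all n P' ds1 r0"
    have nonneg: "\<forall>j<m. 0 \<le> ?r j" using feasible_eat_all_nonneg[OF split(1)] .
    \<comment> \<open>At time \<open>t\<close> the truthful run has nothing left of
      \<open>S\<close>, so all that the manipulated run has left there is excess.\<close>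
    have "(\<Sum>j\<in>S. ?r j) = (\<Sum>j\<in>S. max 0 (?r j - remaining (st q) j))"
      using q nonneg S(1) by (intro sum.cong) auto
    also have "\<dots> \<le> excess m (eat_all n P ds r0) ?r"
      unfolding excess_def ds(2) using S(1) by (intro sum_mono2) auto
    also have "\<dots> \<le> excess m r0 r0 + t"
      using excess_eat_all[OF prefs prefs' _ \<open>0 < n\<close> ds(1) split(1)] ds(3) split(2)
      by (simp add: P'_def)
    finally have left: "(\<Sum>j\<in>S. ?r j) \<le> t" by (simp add: excess_def)
    have "2 \<le> eaters n P' ?r j" if j: "j \<in> S" "0 < ?r j" for j
    proof -
      have "?r j \<le> (\<Sum>j\<in>S. ?r j)"
        using j S nonneg by (intro member_le_sum) auto
      \<comment> \<open>The item began with supply \<open>1\<close> and has at most \<open>t\<close>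
        left.\<close>
      then have "1 - t \<le> r0 j - ?r j" using left j S by (auto simp: r0_def)
      also have "\<dots> \<le> real (eaters n P' ?r j) * t"
        using eaten_le_eaters_times_duration[OF prefs' split(1) _ j(2)] j(1) S(1) split(2) by auto
      \<comment> \<open>Here \<open>t < 1/2\<close> enters as \<open>t < 1 - t\<close>: a single
        eater could not have consumed this much by time \<open>t\<close>.\<close>
      finally have "1 * t < real (eaters n P' ?r j) * t"
        using \<open>t \<le> T\<close> \<open>T < 1/2\<close> by linarith
      then have "1 < real (eaters n P' ?r j)"
        using \<open>0 \<le> t\<close> by (rule mult_right_less_imp_less)
      then show ?thesis by linarith
    qed
    then have "gain n P' S ds2 ?r \<le> (\<Sum>j\<in>S. ?r j) / 2"
      using gain_le_half[OF prefs' \<open>0 < n\<close> S(1) split(3)] by blast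
    \<comment> \<open>At most \<open>t\<close> is gained before the cut and at most
      \<open>t / 2\<close> after it.\<close>
    then show ?thesis using split(2,4) left gain_le_sum[OF split(1), of S] by simp
  qed
  then show ?thesis using truthful ds'(2) by (simp add: S_def P'_def)
qed

end
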